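(* Let $G$ be a finitely generated residually finite group and let $X=(X_i)_{i\ge 0}$ be any unbounded changing alphabet. Then $G$ is self-similar over $X$, and this is realized by an optimal automaton: there exists a self-similar (in particular invertible) time-varying automaton $A=(X,Q,\varphi,\psi)$ over $X$ such that $G(A)\simeq G$ and $|Q|=r(G(A))$, where $r(\cdot)$ denotes the rank, i.e. the minimal cardinality of a generating set.
   Context: A changing alphabet is an infinite sequence $X=(X_i)_{i\ge 0}$ of finite sets (alphabets); it is unbounded if the sequence of cardinalities $(|X_i|)_{i\ge0}$ is unbounded. For $k\ge 0$ put $X_{(k)}=(X_{k+i})_{i\ge 0}$. The tree $X^*$ consists of the empty word $\epsilon$ and all finite words $x_0x_1\ldots x_m$ ($m\ge0$) with $x_j\in X_j$; similarly $X_{(k)}^*$ consists of $\epsilon$ and all finite words $x_0x_1\ldots x_m$ with $x_j\in X_{k+j}$. A time-varying automaton over $X$ is a quadruple $A=(X,Q,\varphi,\psi)$, where $Q$ is a finite set (of states), $\varphi=(\varphi_i)_{i\ge0}$ and $\psi=(\psi_i)_{i\ge0}$ are sequences of functions $\varphi_i\colon Q\times X_i\to Q$ (transition functions) and $\psi_i\colon Q\times X_i\to X_i$ (output functions). It is invertible if for all $i\ge0$ and $q\in Q$ the map $x\mapsto\psi_i(q,x)$ is a permutation of $X_i$. For $k\ge 0$, the $k$-th shift of $A$ is the automaton $A_k=(X_{(k)},Q,(\varphi_{k+i})_{i\ge0},(\psi_{k+i})_{i\ge 0})$. For $q\in Q$ and $k\ge0$, the transformation $q_k\colon X_{(k)}^*\to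 X_{(k)}^*$ is defined recursively by $q_k(\epsilon)=\epsilon$ and $q_k(xw)=\psi_k(q,x)\,q'_{k+1}(w)$ with $q'=\varphi_k(q,x)$, for $x\in X_k$, $w\in X_{(k+1)}^*$. If $A$ is invertible, each $q_k$ is an automorphism of the rooted tree $X_{(k)}^*$, and $G(A_k)=\langle q_k : q\in Q\rangle$ denotes the group generated by these transformations under composition; $G(A)=G(A_0)$. Compositions are written with the right action convention: $fg(w)=g(f(w))$. An invertible time-varying automaton $A$ is self-similar if for every $k\ge 0$ the mapping $q_k\mapsto q_0$ ($q\in Q$) induces (i.e. extends to) a group isomorphism $G(A_k)\simeq G(A)$. A group $G$ is self-similar over the changing alphabet $X$ if there is a self-similar automaton $A=(X,Q,\varphi,\psi)$ with $G(A)\simeq G$. An automaton $A=(X,Q,\varphi,\psi)$ is optimal if $|Q|=r(G(A))$. A group is residually finite if it has a descending chain $N_0\ge N_1\ge N_2\ge\ldots$ of normal subgroups of finite index with trivial intersection. *)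

theory Defs
  imports "HOL-Algebra.Bij" "HOL-Algebra.Generated_Groups"
begin

section \<open>Changing alphabets and their trees\<close>

text \<open>
  Alphabets are nonempty. (If some level were empty, the tree would be finite,
  and no infinite group could be self-similar over the sequence.)
\<close>

definition changing_alphabet :: "(nat \<Rightarrow> 'a set) \<Rightarrow> bool" where
  "changing_alphabet X \<longleftrightarrow> (\<forall>i. finite (X i) \<and> X i \<noteq> {})"

definition unbounded_alphabet :: "(nat \<Rightarrow> 'a set) \<Rightarrow> bool" where
  "unbounded_alphabet X \<longleftrightarrow> \<not> bdd_above (range (\<lambda>i. card (X i)))"

definition shift_seq :: "nat \<Rightarrow> (nat \<Rightarrow> 'b) \<Rightarrow> nat \<Rightarrow> 'b" where
  "shift_seq k X = (\<lambda>i. X (k + i))"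

definition tree :: "(nat \<Rightarrow> 'a set) \<Rightarrow> 'a list set" where
  "tree X = {w. \<forall>j < length w. w ! j \<in> X j}"


section \<open>Time-varying automata\<close>

record ('a, 'q) tv_automaton =
  alphabet :: "nat \<Rightarrow> 'a set"
  states :: "'q set"
  transition :: "nat \<Rightarrow> 'q \<Rightarrow> 'a \<Rightarrow> 'q"
  out :: "nat \<Rightarrow> 'q \<Rightarrow> 'a \<Rightarrow> 'a"

text \<open>
  The state set may be empty; an optimal automaton generating the trivial group,
  which has rank 0, has no states.
\<close>

definition time_varying_automaton :: "('a, 'q) tv_automaton \<Rightarrow> bool" where
  "time_varying_automaton A \<longleftrightarrow>
     changing_alphabet (alphabet A) \<and> finite (states A) \<and>
     (\<forall>i. \<forall>q \<in> states A. \<forall>x \<in> alphabet A i.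
        transition A i q x \<in> states A \<and> out A i q x \<in> alphabet A i)"

definition invertible_automaton :: "('a, 'q) tv_automaton \<Rightarrow> bool" where
  "invertible_automaton A \<longleftrightarrow>
     time_varying_automaton A \<and>
     (\<forall>i. \<forall>q \<in> states A. bij_betw (out A i q) (alphabet A i) (alphabet A i))"

definition shift_automaton :: "nat \<Rightarrow> ('a, 'q) tv_automaton \<Rightarrow> ('a, 'q) tv_automaton" where
  "shift_automaton k A =
     \<lparr>alphabet = shift_seq k (alphabet A), states = states A,
      transition = shift_seq k (transition A), out = shift_seq k (out A)\<rparr>"

primrec run :: "('a, 'q) tv_automaton \<Rightarrow> nat \<Rightarrow> 'q \<Rightarrow> 'a list \<Rightarrow> 'a list" where
  "run A k q [] = []"
| "run A k q (x # w) = out A k q x # run A (Suc k) (transition A k q x) w"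
  for A

text \<open>
  The transformation $q_k$ of the tree $X_{(k)}^*$, as an extensional function
  (so that equality of functions is equality on the tree).
\<close>

definition state_map :: "('a, 'q) tv_automaton \<Rightarrow> nat \<Rightarrow> 'q \<Rightarrow> 'a list \<Rightarrow> 'a list" where
  "state_map A k q = restrict (run A k q) (tree (shift_seq k (alphabet A)))"


section \<open>The group generated by an automaton\<close>

text \<open>
  \<^const>\<open>BijGroup\<close> composes from right to left; here \<open>f \<otimes> g\<close> is
  ``first \<open>f\<close>, then \<open>g\<close>''.
\<close>

definition perm_group :: "'b set \<Rightarrow> ('b \<Rightarrow> 'b) monoid" where
  "perm_group S = BijGroup S \<lparr>mult := \<lambda>f g. g \<otimes>\<^bsub>BijGroup S\<^esub> f\<rparr>"

text \<open>
  \<open>automaton_group A k\<close> is $G(A_k)$. For an invertible automaton all generators are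
  elements of the ambient group, so the intersection with its carrier which is built into
  \<^const>\<open>subgroup_generated\<close> discards nothing; see \<open>state_map_in_perm_group\<close> below.
\<close>

definition automaton_group :: "('a, 'q) tv_automaton \<Rightarrow> nat \<Rightarrow> ('a list \<Rightarrow> 'a list) monoid" where
  "automaton_group A k =
     subgroup_generated (perm_group (tree (shift_seq k (alphabet A)))) (state_map A k ` states A)"

lemma perm_group_simps:
  "carrier (perm_group S) = Bij S"
  "\<one>\<^bsub>perm_group S\<^esub> = (\<lambda>x\<in>S. x)"
  "f \<in> Bij S \<Longrightarrow> g \<in> Bij S \<Longrightarrow> f \<otimes>\<^bsub>perm_group S\<^esub> g = compose S g f"
  by (simp_all add: perm_group_def BijGroup_def)

lemma group_perm_group: "group (perm_group S)"
proof -
  interpret B: group "BijGroup S" by (rule group_BijGroup)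
  show ?thesis
  proof (rule groupI)
    fix x assume x: "x \<in> carrier (perm_group S)"
    then show "\<exists>y\<in>carrier (perm_group S). y \<otimes>\<^bsub>perm_group S\<^esub> x = \<one>\<^bsub>perm_group S\<^esub>"
      by (intro bexI[of _ "inv\<^bsub>BijGroup S\<^esub> x"]) (auto simp: perm_group_def)
  qed (auto simp: perm_group_def B.m_assoc)
qed

lemma tree_Nil [simp]: "[] \<in> tree X"
  by (simp add: tree_def)

lemma tree_Cons_iff: "x # w \<in> tree X \<longleftrightarrow> x \<in> X 0 \<and> w \<in> tree (shift_seq 1 X)"
  by (auto simp: tree_def shift_seq_def nth_Cons less_Suc_eq_0_disj split: nat.splits)

lemma shift_seq_shift_seq: "shift_seq 1 (shift_seq k X) = shift_seq (Suc k) X"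
  by (auto simp: shift_seq_def)

lemma tree_shift_Cons_iff:
  "x # w \<in> tree (shift_seq k X) \<longleftrightarrow> x \<in> X k \<and> w \<in> tree (shift_seq (Suc k) X)"
  unfolding tree_Cons_iff shift_seq_shift_seq by (simp add: shift_seq_def)

lemma length_run [simp]: "length (run A k q w) = length w"
  by (induction w arbitrary: k q) auto

lemma run_take: "run A k q (take n w) = take n (run A k q w)"
  by (induction w arbitrary: k q n) (auto simp: take_Cons split: nat.splits)

lemma run_in_tree:
  assumes "time_varying_automaton A" "q \<in> states A" "w \<in> tree (shift_seq k (alphabet A))"
  shows "run A k q w \<in> tree (shift_seq k (alphabet A))"
  using assms(2,3)
proof (induction w arbitrary: k q)
  case (Cons x w)
  then show ?case
    using assms(1) by (auto simp: tree_shift_Cons_iff time_varying_automaton_def)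
qed simp

lemma bij_betw_run:
  assumes inv: "invertible_automaton A" and q: "q \<in> states A"
  shows "bij_betw (run A k q) (tree (shift_seq k (alphabet A))) (tree (shift_seq k (alphabet A)))"
proof -
  have A: "time_varying_automaton A"
    using inv by (simp add: invertible_automaton_def)
  have bij: "bij_betw (out A i p) (alphabet A i) (alphabet A i)" if "p \<in> states A" for i p
    using inv that by (simp add: invertible_automaton_def)
  have inj: "v = w"
    if "p \<in> states A" "v \<in> tree (shift_seq k (alphabet A))"
      "w \<in> tree (shift_seq k (alphabet A))" "run A k p v = run A k p w" for k p v w
    using that
  proof (induction v arbitrary: k p w)
    case Nil
    then show ?case by (cases w) auto
  next
    case (Cons x v)
    then obtain y u where w: "w = y # u" by (cases w) auto
    have "x = y"
      using Cons.prems bij[of p k] by (auto simp: w tree_shift_Cons_iff bij_betw_def inj_on_def)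
    moreover have "transition A k p x \<in> states A"
      using Cons.prems A by (auto simp: tree_shift_Cons_iff time_varying_automaton_def)
    ultimately show ?case
      using Cons.IH[of "transition A k p x" "Suc k" u] Cons.prems
      by (auto simp: w tree_shift_Cons_iff)
  qed
  have surj: "\<exists>v \<in> tree (shift_seq k (alphabet A)). run A k p v = w"
    if "p \<in> states A" "w \<in> tree (shift_seq k (alphabet A))" for k p w
    using that
  proof (induction w arbitrary: k p)
    case Nil
    show ?case by (rule bexI[of _ "[]"]) auto
  next
    case (Cons y w)
    then have "y \<in> out A k p ` alphabet A k"
      using bij[of p k] by (auto simp: tree_shift_Cons_iff bij_betw_def)
    then obtain x where x: "x \<in> alphabet A k" "out A k p x = y" by blast
    then have "transition A k p x \<in> states A"
      using Cons.prems A by (auto simp: time_varying_automaton_def)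
    then obtain v where "v \<in> tree (shift_seq (Suc k) (alphabet A))"
      "run A (Suc k) (transition A k p x) v = w"
      using Cons.IH Cons.prems(2) by (auto simp: tree_shift_Cons_iff)
    with x show ?case
      by (intro bexI[of _ "x # v"]) (auto simp: tree_shift_Cons_iff)
  qed
  show ?thesis
    unfolding bij_betw_def inj_on_def
    using inj[OF q] surj[OF q] run_in_tree[OF A q] by blast
qed

lemma state_map_in_perm_group:
  assumes "invertible_automaton A" "q \<in> states A"
  shows "state_map A k q \<in> carrier (perm_group (tree (shift_seq k (alphabet A))))"
  using bij_betw_run[OF assms, of k]
  by (simp add: perm_group_simps Bij_def state_map_def cong: bij_betw_cong)

lemma run_shift_automaton: "run (shift_automaton k A) i q w = run A (k + i) q w"
  by (induction w arbitrary: i q) (simp_all add: shift_automaton_def shift_seq_def)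

lemma automaton_group_shift: "automaton_group (shift_automaton k A) 0 = automaton_group A k"
proof -
  have "shift_seq 0 (alphabet (shift_automaton k A)) = shift_seq k (alphabet A)"
    "states (shift_automaton k A) = states A"
    by (simp_all add: shift_automaton_def shift_seq_def)
  moreover have "run (shift_automaton k A) 0 = run A k"
    by (simp add: fun_eq_iff run_shift_automaton)
  ultimately show ?thesis by (simp add: automaton_group_def state_map_def)
qed


section \<open>Group-theoretic notions\<close>

definition finitely_generated :: "('g, 'm) monoid_scheme \<Rightarrow> bool" where
  "finitely_generated G \<longleftrightarrow> (\<exists>S \<subseteq> carrier G. finite S \<and> generate G S = carrier G)"

definition residually_finite :: "('g, 'm) monoid_scheme \<Rightarrow> bool" where
  "residually_finite G \<longleftrightarrow>
     (\<exists>N :: nat \<Rightarrow> 'g set.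
        (\<forall>i. N i \<lhd> G \<and> finite (rcosets\<^bsub>G\<^esub> (N i)) \<and> N (Suc i) \<subseteq> N i) \<and>
        (\<Inter>i. N i) = {\<one>\<^bsub>G\<^esub>})"

text \<open>Only meaningful for finitely generated groups.\<close>

definition group_rank :: "('g, 'm) monoid_scheme \<Rightarrow> nat" where
  "group_rank G =
     (LEAST n. \<exists>S \<subseteq> carrier G. finite S \<and> card S = n \<and> generate G S = carrier G)"


section \<open>Self-similarity and optimality\<close>

text \<open>
  The map $q_k \mapsto q_0$ on generators need not be well defined a priori;
  if it is not, no \<open>h\<close> as below exists.
\<close>

definition self_similar_automaton :: "('a, 'q) tv_automaton \<Rightarrow> bool" where
  "self_similar_automaton A \<longleftrightarrow>
     invertible_automaton A \<and>
     (\<forall>k. \<exists>h \<in> iso (automaton_group A k) (automaton_group A 0).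
        \<forall>q \<in> states A. h (state_map A k q) = state_map A 0 q)"

definition optimal_automaton :: "('a, 'q) tv_automaton \<Rightarrow> bool" where
  "optimal_automaton A \<longleftrightarrow> card (states A) = group_rank (automaton_group A 0)"

text \<open>
  State sets are finite, so up to renaming they are sets of natural numbers.
\<close>

definition self_similar_over :: "('g, 'm) monoid_scheme \<Rightarrow> (nat \<Rightarrow> 'a set) \<Rightarrow> bool" where
  "self_similar_over G X \<longleftrightarrow>
     (\<exists>A :: ('a, nat) tv_automaton.
        alphabet A = X \<and> self_similar_automaton A \<and> automaton_group A 0 \<cong> G)"

end

theory Submission
  imports Defs
begin

text \<open>
  A finite quotient \<open>G / N\<close> acts faithfully on every alphabet with at least \<open>|G / N|\<close> letters,
  by right translation of cosets, all remaining letters being fixed. As \<open>X\<close> is unbounded, one can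
  let \<open>G\<close> act on each level \<open>X i\<close> in such a way that every member \<open>N j\<close> of a descending chain of
  normal subgroups of finite index with trivial intersection contains the kernel of this action
  for arbitrarily large \<open>i\<close>. Acting letter by letter, \<open>G\<close> then embeds into the permutations
  of the tree $X_{(k)}^*$ for every \<open>k\<close>. These actions are realized by the automaton whose states
  correspond to a minimal generating set of \<open>G\<close> and never change.
\<close>

section \<open>Right actions\<close>

text \<open>Actions are on the right because \<open>perm_group\<close> composes from left to right:
  such actions induce homomorphisms, not antihomomorphisms. Values outside \<open>S\<close> are left
  free, so that a letter action can serve directly as an output function.\<close>

definition right_action :: "('g, 'm) monoid_scheme \<Rightarrow> 's set \<Rightarrow> ('g \<Rightarrow> 's \<Rightarrow> 's) \<Rightarrow> bool" where
  "right_action G S a \<longleftrightarrow>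
     (\<forall>x\<in>S. a \<one>\<^bsub>G\<^esub> x = x) \<and>
     (\<forall>g\<in>carrier G. \<forall>x\<in>S. a g x \<in> S) \<and>
     (\<forall>g\<in>carrier G. \<forall>h\<in>carrier G. \<forall>x\<in>S. a (g \<otimes>\<^bsub>G\<^esub> h) x = a h (a g x))"

lemma right_actionD:
  assumes "right_action G S a" "x \<in> S"
  shows "a \<one>\<^bsub>G\<^esub> x = x"
    and "g \<in> carrier G \<Longrightarrow> a g x \<in> S"
    and "g \<in> carrier G \<Longrightarrow> h \<in> carrier G \<Longrightarrow> a (g \<otimes>\<^bsub>G\<^esub> h) x = a h (a g x)"
  using assms by (auto simp: right_action_def)

lemma (in group) right_action_bij_betw:
  assumes "right_action G S a" "g \<in> carrier G"
  shows "bij_betw (a g) S S"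
proof -
  note a = right_actionD[OF assms(1)]
  show ?thesis
  proof (rule bij_betw_byWitness[where f' = "a (inv g)"])
    show "\<forall>x\<in>S. a (inv g) (a g x) = x" "\<forall>x\<in>S. a g (a (inv g) x) = x"
      using assms(2) a(1) by (auto simp flip: a(3))
  qed (use assms(2) a(2) in auto)
qed

lemma (in group) right_action_hom:
  assumes "right_action G S a"
  shows "(\<lambda>g. restrict (a g) S) \<in> hom G (perm_group S)"
proof (rule homI)
  have Bij: "restrict (a g) S \<in> Bij S" if "g \<in> carrier G" for g
    using right_action_bij_betw[OF assms that] by (simp add: Bij_def cong: bij_betw_cong)
  then show "restrict (a g) S \<in> carrier (perm_group S)" if "g \<in> carrier G" for g
    using that by (simp add: perm_group_simps)
  show "restrict (a (g \<otimes> h)) S = restrict (a g) S \<otimes>\<^bsub>perm_group S\<^esub> restrict (a h) S"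
    if "g \<in> carrier G" "h \<in> carrier G" for g h
    using right_actionD[OF assms] that
    by (auto simp: perm_group_simps Bij compose_def intro!: restrict_ext)
qed

lemma (in group) right_action_rcosets:
  assumes "subgroup H G"
  shows "right_action G (rcosets H) (\<lambda>g C. C #> g)"
proof -
  have C: "C \<subseteq> carrier G" if "C \<in> rcosets H" for C
    using that r_coset_subset_G[OF subgroup.subset[OF assms]] by (auto simp: RCOSETS_def)
  have "C #> g \<in> rcosets H" if "C \<in> rcosets H" "g \<in> carrier G" for C g
    using that subgroup.subset[OF assms] by (auto simp: RCOSETS_def coset_mult_assoc)
  then show ?thesis
    using C by (auto simp: right_action_def coset_mult_assoc)
qed

text \<open>The action is transported along the injection \<open>e\<close>, and points outside its
  image are fixed. The image is invariant, so the two cases never mix.\<close>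

lemma right_action_extend:
  assumes "right_action G T b" "inj_on e T" "e ` T \<subseteq> S"
  shows "right_action G S (\<lambda>g y. if y \<in> e ` T then e (b g (the_inv_into T e y)) else y)"
proof -
  define a where "a = (\<lambda>g y. if y \<in> e ` T then e (b g (the_inv_into T e y)) else y)"
  have a_e: "a g (e t) = e (b g t)" if "t \<in> T" for g t
    using that assms(2) by (simp add: a_def the_inv_into_f_f)
  have a_other: "a g y = y" if "y \<notin> e ` T" for g y
    using that by (simp add: a_def)
  have "a \<one>\<^bsub>G\<^esub> y = y \<and> (\<forall>g\<in>carrier G. a g y \<in> S \<and>
      (\<forall>h\<in>carrier G. a (g \<otimes>\<^bsub>G\<^esub> h) y = a h (a g y)))" if "y \<in> S" for y
  proof (cases "y \<in> e ` T")
    case True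
    then show ?thesis
      using right_actionD[OF assms(1)] assms(3) by (auto simp: a_e)
  qed (simp add: a_other that)
  then show ?thesis
    unfolding a_def[symmetric] by (simp add: right_action_def)
qed

text \<open>The right cosets embed into \<open>S\<close>, and the stabilizer of the coset
  \<open>N\<close> under right translation is \<open>N\<close> itself; anything acting trivially
  must lie in it.\<close>

lemma (in group) finite_index_right_action:
  assumes "subgroup N G" "finite (rcosets N)" "finite S" "card (rcosets N) \<le> card S"
  shows "\<exists>a. right_action G S a \<and> (\<forall>g\<in>carrier G. (\<forall>x\<in>S. a g x = x) \<longrightarrow> g \<in> N)"
proof -
  obtain e where e: "inj_on e (rcosets N)" "e ` (rcosets N) \<subseteq> S"
    using card_le_inj[OF assms(2-4)] by blast
  define a where
    "a = (\<lambda>g y. if y \<in> e ` (rcosets N) then e (the_inv_into (rcosets N) e y #> g) else y)"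
  have "right_action G S a"
    unfolding a_def by (rule right_action_extend[OF right_action_rcosets[OF assms(1)] e])
  moreover have "g \<in> N" if g: "g \<in> carrier G" and fixed: "\<forall>x\<in>S. a g x = x" for g
  proof -
    have N: "N \<in> rcosets N"
      using subgroup.subgroup_in_rcosets[OF assms(1) is_group] .
    have "N #> g \<in> rcosets N"
      using g N right_actionD(2)[OF right_action_rcosets[OF assms(1)]] by blast
    moreover have "a g (e N) = e (N #> g)"
      using N e(1) by (simp add: a_def the_inv_into_f_f)
    then have "e (N #> g) = e N"
      using fixed N e(2) by auto
    ultimately have "N #> g = N"
      using e(1) N by (auto dest: inj_onD)
    then show ?thesis
      using coset_join1 g assms(1) by blast
  qed
  ultimately show ?thesis by blast
qed


section \<open>Acting on the levels of an unbounded alphabet\<close>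

lemma unbounded_alphabetE:
  assumes "unbounded_alphabet X"
  obtains i where "k \<le> i" "n \<le> card (X i)"
proof -
  \<comment> \<open>The sum dominates the size of each of the first \<open>k\<close> levels, so a
    level exceeding this bound has index at least \<open>k\<close>.\<close>
  have "\<not> (\<forall>i. card (X i) \<le> n + (\<Sum>i<k. card (X i)))"
    using assms by (auto simp: unbounded_alphabet_def bdd_above_def)
  then obtain i where i: "n + (\<Sum>i<k. card (X i)) < card (X i)"
    by (auto simp: not_le)
  have "k \<le> i"
  proof (rule ccontr)
    assume "\<not> k \<le> i"
    then have "card (X i) \<le> (\<Sum>i<k. card (X i))"
      by (intro member_le_sum) auto
    with i show False by simp
  qed
  with i that show ?thesis by auto
qed

text \<open>Level \<open>i\<close> uses the deepest \<open>N j\<close> with \<open>j \<le> i\<close>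
  whose cosets fit into \<open>X i\<close>. Each fixed \<open>j\<close> is a candidate at
  arbitrarily late levels, so an element trivial on all levels from \<open>k\<close> on lies in
  every \<open>N j\<close>.\<close>

lemma (in group) residually_finite_level_actions:
  assumes "residually_finite G" "changing_alphabet X" "unbounded_alphabet X"
  obtains a where "\<And>i. right_action G (X i) (a i)"
    and "\<forall>k. \<forall>g\<in>carrier G. (\<forall>i\<ge>k. \<forall>x\<in>X i. a i g x = x) \<longrightarrow> g = \<one>"
proof -
  obtain N where N: "\<And>i. N i \<lhd> G" "\<And>i. finite (rcosets (N i))"
    and dec: "\<And>i. N (Suc i) \<subseteq> N i" and Inter: "(\<Inter>i. N i) = {\<one>}"
    using assms(1) by (auto simp: residually_finite_def)
  have fin: "finite (X i)" for i
    using assms(2) by (auto simp: changing_alphabet_def)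
  have "\<exists>a. right_action G (X i) a \<and>
      (\<forall>j\<le>i. card (rcosets (N j)) \<le> card (X i) \<longrightarrow>
        (\<forall>g\<in>carrier G. (\<forall>x\<in>X i. a g x = x) \<longrightarrow> g \<in> N j))" for i
  proof -
    \<comment> \<open>The bound \<open>j \<le> i\<close> keeps \<open>J\<close> finite, so that
      \<open>Max J\<close> exists even when all indices are small enough, as for a finite
      group.\<close>
    define J where "J = {j. j \<le> i \<and> card (rcosets (N j)) \<le> card (X i)}"
    have J: "finite J" by (simp add: J_def)
    show ?thesis
    proof (cases "J = {}")
      case True
      then show ?thesis
        \<comment> \<open>No quotient fits, so the trivial action will do.\<close>
        by (intro exI[of _ "\<lambda>g x. x"]) (auto simp: right_action_def J_def)
    next
      case False
      have "card (rcosets (N (Max J))) \<le> card (X i)"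
        using Max_in[OF J False] by (simp add: J_def)
      then obtain a where "right_action G (X i) a"
        and "\<forall>g\<in>carrier G. (\<forall>x\<in>X i. a g x = x) \<longrightarrow> g \<in> N (Max J)"
        using finite_index_right_action[OF normal_imp_subgroup[OF N(1)] N(2) fin] by blast
      \<comment> \<open>The chain descends, so the largest index controls all candidates at
        once.\<close>
      moreover have "N (Max J) \<subseteq> N j" if "j \<in> J" for j
        using lift_Suc_antimono_le[of N, OF dec] Max_ge[OF J that] by blast
      ultimately show ?thesis
        by (intro exI[of _ a]) (auto simp: J_def)
    qed
  qed
  then obtain a where a: "\<And>i. right_action G (X i) (a i)"
    and ker: "\<And>i j g. j \<le> i \<Longrightarrow> card (rcosets (N j)) \<le> card (X i) \<Longrightarrow> g \<in> carrier G \<Longrightarrow>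
      \<forall>x\<in>X i. a i g x = x \<Longrightarrow> g \<in> N j"
    by metis
  have "g = \<one>" if g: "g \<in> carrier G" and fixed: "\<forall>i\<ge>k. \<forall>x\<in>X i. a i g x = x" for g k
  proof -
    have "g \<in> N j" for j
    proof -
      \<comment> \<open>Here \<open>k \<le> i\<close> makes \<open>g\<close> trivial on level
        \<open>i\<close>, and \<open>j \<le> i\<close> makes \<open>j\<close> a candidate
        there.\<close>
      obtain i where i: "max k j \<le> i" "card (rcosets (N j)) \<le> card (X i)"
        using unbounded_alphabetE[OF assms(3)] by blast
      show ?thesis
        using ker[OF _ i(2) g] i(1) fixed by simp
    qed
    then have "g \<in> (\<Inter>i. N i)" by blast
    with Inter show ?thesis by simp
  qed
  with a that show ?thesis by blast
qed


section \<open>Letterwise actions on trees\<close>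

primrec letterwise :: "(nat \<Rightarrow> 'a \<Rightarrow> 'a) \<Rightarrow> nat \<Rightarrow> 'a list \<Rightarrow> 'a list" where
  "letterwise f k [] = []"
| "letterwise f k (x # w) = f k x # letterwise f (Suc k) w"

lemma run_constant_transition:
  "run \<lparr>alphabet = X, states = Q, transition = \<lambda>_ q _. q, out = f\<rparr> k q w =
     letterwise (\<lambda>i. f i q) k w"
  by (induction w arbitrary: k) auto

lemma nth_letterwise: "j < length w \<Longrightarrow> letterwise f k w ! j = f (k + j) (w ! j)"
  by (induction w arbitrary: k j) (auto simp: nth_Cons split: nat.splits)

lemma right_action_letterwise:
  assumes "\<And>i. right_action G (X i) (a i)"
  shows "right_action G (tree (shift_seq k X)) (\<lambda>g. letterwise (\<lambda>i. a i g) k)"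
proof -
  note a = right_actionD[OF assms]
  have "letterwise (\<lambda>i. a i \<one>\<^bsub>G\<^esub>) k w = w" if "w \<in> tree (shift_seq k X)" for w
    using that by (induction w arbitrary: k) (auto simp: tree_shift_Cons_iff a(1))
  moreover have "letterwise (\<lambda>i. a i g) k w \<in> tree (shift_seq k X)"
    if "g \<in> carrier G" "w \<in> tree (shift_seq k X)" for g w
    using that(2) by (induction w arbitrary: k) (auto simp: tree_shift_Cons_iff a(2) that(1))
  moreover have "letterwise (\<lambda>i. a i (g \<otimes>\<^bsub>G\<^esub> h)) k w =
      letterwise (\<lambda>i. a i h) k (letterwise (\<lambda>i. a i g) k w)"
    if "g \<in> carrier G" "h \<in> carrier G" "w \<in> tree (shift_seq k X)" for g h w
    using that(3) by (induction w arbitrary: k) (auto simp: tree_shift_Cons_iff a(3) that(1,2))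
  ultimately show ?thesis by (simp add: right_action_def)
qed

text \<open>Serves to carry faithfulness from letters to words: an element fixing every word from
  level \<open>k\<close> on fixes every letter there. Nonempty alphabets supply the other
  positions.\<close>

lemma letter_in_tree:
  assumes "changing_alphabet X" "k \<le> i" "x \<in> X i"
  obtains w where "w \<in> tree (shift_seq k X)" "i - k < length w" "w ! (i - k) = x"
proof
  define c where "c j = (if k + j = i then x else SOME y. y \<in> X (k + j))" for j
  have "c j \<in> X (k + j)" for j
    using assms by (auto simp: c_def changing_alphabet_def some_in_eq)
  then show "map c [0..<Suc (i - k)] \<in> tree (shift_seq k X)"
    by (auto simp: tree_def shift_seq_def simp del: upt_Suc)
  show "map c [0..<Suc (i - k)] ! (i - k) = x"
    using assms(2) by (simp add: c_def del: upt_Suc)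
qed simp


section \<open>Rank and generation under isomorphisms\<close>

lemma generating_set_iso:
  assumes "group G" "group H" "G \<cong> H"
    and "\<exists>S\<subseteq>carrier G. finite S \<and> card S = n \<and> generate G S = carrier G"
  shows "\<exists>S\<subseteq>carrier H. finite S \<and> card S = n \<and> generate H S = carrier H"
proof -
  obtain h where h: "h \<in> iso G H"
    using assms(3) by (auto simp: is_iso_def)
  interpret group_hom G H h
    using assms(1,2) h by (auto simp: group_hom_def group_hom_axioms_def iso_def)
  obtain S where S: "S \<subseteq> carrier G" "finite S" "card S = n" "generate G S = carrier G"
    using assms(4) by blast
  have bij: "bij_betw h (carrier G) (carrier H)"
    using h by (simp add: iso_def)
  have "card (h ` S) = n"
    using S bij by (metis bij_betw_def card_image inj_on_subset)
  moreover have "generate H (h ` S) = carrier H"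
    using generate_img[OF S(1)] S(4) bij by (simp add: bij_betw_def)
  ultimately show ?thesis
    using S by (intro exI[of _ "h ` S"]) auto
qed

lemma group_rank_iso:
  assumes "group G" "group H" "G \<cong> H"
  shows "group_rank G = group_rank H"
proof -
  have "(\<exists>S\<subseteq>carrier G. finite S \<and> card S = n \<and> generate G S = carrier G) \<longleftrightarrow>
      (\<exists>S\<subseteq>carrier H. finite S \<and> card S = n \<and> generate H S = carrier H)" for n
    using generating_set_iso[OF assms] generating_set_iso[OF assms(2,1) group.iso_sym[OF assms(1,3)]]
    by (rule iffI)
  then show ?thesis by (simp add: group_rank_def)
qed

lemma group_rank_generating_set:
  assumes "finitely_generated G"
  obtains S where "S \<subseteq> carrier G" "finite S" "card S = group_rank G" "generate G S = carrier G"
proof -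
  have "\<exists>n. \<exists>S\<subseteq>carrier G. finite S \<and> card S = n \<and> generate G S = carrier G"
    using assms by (auto simp: finitely_generated_def)
  from LeastI_ex[OF this] that show ?thesis
    unfolding group_rank_def by blast
qed

text \<open>An injective homomorphism is an isomorphism onto its image, which is generated by the
  images of generators. The conclusion has the shape of \<open>automaton_group\<close>.\<close>

lemma (in group_hom) iso_subgroup_generated_image:
  assumes "inj_on h (carrier G)" "S \<subseteq> carrier G" "generate G S = carrier G"
  shows "h \<in> iso G (subgroup_generated H (h ` S))"
proof -
  have "carrier H \<inter> h ` S = h ` S"
    using assms(2) by auto
  then have "carrier (subgroup_generated H (h ` S)) = h ` carrier G"
    using generate_img[OF assms(2)] assms(3) by (simp add: carrier_subgroup_generated)
  with assms(1) show ?thesis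
    by (auto simp: iso_def hom_def bij_betw_def)
qed


section \<open>Automata with constant states\<close>

text \<open>State \<open>q\<close> acts at every level as the group element \<open>s q\<close>.
  Faithfulness on each tail of levels makes the action on every shifted tree an embedding of
  \<open>G\<close>, so all shifts generate the same group with matching generators.\<close>

lemma (in group) constant_state_automaton:
  assumes "changing_alphabet X" "finite Q"
    and act: "\<And>i. right_action G (X i) (a i)"
    and faithful: "\<forall>k. \<forall>g\<in>carrier G. (\<forall>i\<ge>k. \<forall>x\<in>X i. a i g x = x) \<longrightarrow> g = \<one>"
    and s: "s ` Q \<subseteq> carrier G" "generate G (s ` Q) = carrier G"
  defines "A \<equiv> \<lparr>alphabet = X, states = Q, transition = \<lambda>_ q _. q, out = \<lambda>i q. a i (s q)\<rparr>"
  shows "self_similar_automaton A" "G \<cong> automaton_group A k"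
proof -
  define \<beta> where
    "\<beta> k g = restrict (letterwise (\<lambda>i. a i g) k) (tree (shift_seq k X))" for k g
  have bij: "bij_betw (a i (s q)) (X i) (X i)" if "q \<in> Q" for i q
    using right_action_bij_betw[OF act] s(1) that by blast
  have inv: "invertible_automaton A"
    using bij assms(1,2) bij_betw_apply[OF bij]
    by (auto simp: invertible_automaton_def time_varying_automaton_def A_def)
  have state: "state_map A k q = \<beta> k (s q)" for k q
    by (simp add: A_def state_map_def \<beta>_def run_constant_transition fun_eq_iff restrict_def)
  have iso: "\<beta> k \<in> iso G (automaton_group A k)" for k
  proof -
    let ?T = "tree (shift_seq k X)"
    have hom: "\<beta> k \<in> hom G (perm_group ?T)"
      unfolding \<beta>_def by (rule right_action_hom[OF right_action_letterwise[OF act]])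
    interpret h: group_hom G "perm_group ?T" "\<beta> k"
      using hom by (auto simp: group_hom_def group_hom_axioms_def group_perm_group)
    have "g = \<one>" if g: "g \<in> carrier G" and one: "\<beta> k g = \<one>\<^bsub>perm_group ?T\<^esub>" for g
    proof -
      \<comment> \<open>Evaluate \<open>\<beta> k g\<close> on a word whose letter at level
        \<open>i\<close>, that is at position \<open>i - k\<close>, is \<open>x\<close>.\<close>
      have "a i g x = x" if ix: "k \<le> i" "x \<in> X i" for i x
      proof -
        obtain w where w: "w \<in> ?T" "i - k < length w" "w ! (i - k) = x"
          using letter_in_tree[OF assms(1) ix] by blast
        have "\<beta> k g w = w"
          using one w(1) by (simp add: perm_group_simps)
        then have "letterwise (\<lambda>i. a i g) k w = w"
          using w(1) by (simp add: \<beta>_def)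
        then show ?thesis
          using nth_letterwise[OF w(2), of "\<lambda>i. a i g" k] w(3) ix(1) by simp
      qed
      then show ?thesis using faithful g by blast
    qed
    then have "inj_on (\<beta> k) (carrier G)"
      by (simp add: h.inj_on_one_iff)
    then have "\<beta> k \<in> iso G (subgroup_generated (perm_group ?T) (\<beta> k ` s ` Q))"
      using h.iso_subgroup_generated_image s by blast
    moreover have "automaton_group A k = subgroup_generated (perm_group ?T) (\<beta> k ` s ` Q)"
      by (simp add: automaton_group_def state image_image) (simp add: A_def)
    ultimately show ?thesis by simp
  qed
  have "\<exists>h\<in>iso (automaton_group A k) (automaton_group A 0).
      \<forall>q\<in>Q. h (state_map A k q) = state_map A 0 q" for k
  proof (intro bexI ballI)
    \<comment> \<open>Pass back to \<open>G\<close> and down again: \<open>\<beta> k (s q)\<close>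
      goes to \<open>s q\<close> and then to \<open>\<beta> 0 (s q)\<close>.\<close>
    show "\<beta> 0 \<circ> inv_into (carrier G) (\<beta> k)
        \<in> iso (automaton_group A k) (automaton_group A 0)"
      using iso_set_trans[OF iso_set_sym[OF iso] iso] .
    fix q assume "q \<in> Q"
    then have "s q \<in> carrier G" using s(1) by blast
    then show "(\<beta> 0 \<circ> inv_into (carrier G) (\<beta> k)) (state_map A k q) = state_map A 0 q"
      using iso[of k] by (auto simp: state iso_def hom_def bij_betw_def)
  qed
  with inv show "self_similar_automaton A"
    by (simp add: self_similar_automaton_def A_def)
  show "G \<cong> automaton_group A k"
    using iso by (auto simp: is_iso_def)
qed

theorem theorem1:
  fixes G :: "('g, 'm) monoid_scheme" and X :: "nat \<Rightarrow> 'a set"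
  assumes "group G" and "finitely_generated G" and "residually_finite G"
    and "changing_alphabet X" and "unbounded_alphabet X"
  shows "self_similar_over G X \<and>
    (\<exists>A :: ('a, nat) tv_automaton.
       alphabet A = X \<and> self_similar_automaton A \<and>
       automaton_group A 0 \<cong> G \<and> optimal_automaton A)"
proof -
  obtain a where a: "\<And>i. right_action G (X i) (a i)"
    "\<forall>k. \<forall>g\<in>carrier G. (\<forall>i\<ge>k. \<forall>x\<in>X i. a i g x = x) \<longrightarrow> g = \<one>\<^bsub>G\<^esub>"
    by (rule group.residually_finite_level_actions[OF assms(1,3-5)]) blast
  obtain S where S: "S \<subseteq> carrier G" "finite S" "card S = group_rank G" "generate G S = carrier G"
    using group_rank_generating_set[OF assms(2)] by blast
  obtain s where "bij_betw s {0..<card S} S"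
    using ex_bij_betw_nat_finite[OF S(2)] by blast
  then have s: "s ` {0..<group_rank G} = S"
    by (simp add: bij_betw_def S(3))
  \<comment> \<open>The states number a generating set of minimal size; for the trivial group there
    are none.\<close>
  define A :: "('a, nat) tv_automaton" where
    "A = \<lparr>alphabet = X, states = {0..<group_rank G},
       transition = \<lambda>_ q _. q, out = \<lambda>i q. a i (s q)\<rparr>"
  note realized = group.constant_state_automaton
    [where s = s and Q = "{0..<group_rank G}", OF assms(1,4) finite_atLeastLessThan a]
  have A: "self_similar_automaton A" "G \<cong> automaton_group A 0"
    using realized s S by (simp_all add: A_def)
  have "group (automaton_group A 0)"
    by (simp add: automaton_group_def group.group_subgroup_generated group_perm_group)
  \<comment> \<open>Optimality refers to the rank of the generated group, whereas the states were
    counted by the rank of \<open>G\<close>.\<close>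
  then have "group_rank G = group_rank (automaton_group A 0)"
    using group_rank_iso[OF assms(1) _ A(2)] by simp
  moreover have "card (states A) = group_rank G" "alphabet A = X"
    by (simp_all add: A_def)
  ultimately show ?thesis
    using A(1) group.iso_sym[OF assms(1) A(2)] unfolding self_similar_over_def optimal_automaton_def by metis
qed

end
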